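(* Let $G = \langle R \cup D \rangle$ be a constant spinal group, and let $H = \langle R \cup T \rangle$ be a special subgroup of $G$ (with $T\le D$). Assume that $H$ is regular branch over its commutator subgroup $H'$. Let $n \ge 0$ be an integer. If an element $g \in G$ satisfies $g|_u\in H$ for all $u\in X^n$, then $g \in H$.
   Context: For a finite non-empty set $X$, $X^\ast$ denotes the rooted tree of finite words over $X$; $X^n$ is the set of words of length $n$. $\mathrm{Aut}(X^\ast)$ acts on the left. For $g\in\mathrm{Aut}(X^\ast)$ and $v\in X^\ast$, the section $g|_v\in \mathrm{Aut}(X^\ast)$ is defined by $g(vu)=g(v)\,g|_v(u)$ for all $u\in X^\ast$. Constant spinal groups: let $R$ be a finite group with identity $e$, let $X=\underline{R}$ be its underlying set, and write $\underline{r}\in X$ for the letter corresponding to $r\in R$. The group $R$ acts on $X$ by $r\underline{s}=\underline{rs}$, and $r\in R$ is identified with the rooted automorphism $\underline{s}w\mapsto \underline{rs}\,w$ of $X^\ast$. An automorphism $d$ is directed if it fixes every word of length $1$, $d|_{\underline{e}}=d$, and $d|_x\in R$ for all $x\in X\smallsetminus\{\underline{e}\}$. Let $D$ be a group of directed automorphisms with (Gen): $\langle d|_x \mid d\in D,\ x\in X\smallsetminus\{\underline{e}\}\rangle = R$. Then $G=\langle R\cup D\rangle$ is called a constant spinal group. A special subgroup of $G$ is a $G$-conjugate of a subgroup $\langle R\cup T\rangle$, where $T\le D$ also satisfies (Gen), i.e. $\langle t|_x\mid t\in T,\ x\in X\smallsetminus\{\underline e\}\rangle=R$. In the claim $H$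 itself is of the form $\langle R\cup T\rangle$ with such a $T$. For $h_x\in\mathrm{Aut}(X^\ast)$ $(x\in X)$, $(x:h_x)_{x\in X}$ denotes the automorphism fixing $X$ pointwise with section $h_x$ at $x$. A group $H$ acting transitively on each $X^n$ is regular branch over a finite index subgroup $K\le H$ if $\{(x:k_x)_{x\in X}\mid k_x\in K\}$ is contained in $K$ as a subgroup of finite index. *)

theory Defs
  imports "HOL-Algebra.Bij" "HOL-Algebra.Generated_Groups"
begin

section \<open>The rooted tree of words and its automorphism group\<close>

text \<open>The vertices of the tree are the words in \<^term>\<open>lists X\<close>, with root \<^term>\<open>[]\<close>.\<close>

definition word_adj :: "'x list \<Rightarrow> 'x list \<Rightarrow> bool" where
  "word_adj u v \<longleftrightarrow> (\<exists>x. v = u @ [x] \<or> u = v @ [x])"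

definition tree_auts :: "'x set \<Rightarrow> ('x list \<Rightarrow> 'x list) set" where
  "tree_auts X = {f \<in> Bij (lists X). f [] = [] \<and>
     (\<forall>u\<in>lists X. \<forall>v\<in>lists X. word_adj (f u) (f v) \<longleftrightarrow> word_adj u v)}"

text \<open>As in \<^const>\<open>BijGroup\<close>, the product of \<open>g\<close> and \<open>h\<close> is \<open>g \<circ> h\<close> (left action), and all
  automorphisms are \<^const>\<open>undefined\<close> outside \<^term>\<open>lists X\<close>.\<close>

definition tree_Aut :: "'x set \<Rightarrow> ('x list \<Rightarrow> 'x list) monoid" where
  "tree_Aut X = BijGroup (lists X) \<lparr>carrier := tree_auts X\<rparr>"

text \<open>The section of \<open>g\<close> at \<open>v\<close> is the automorphism \<open>h\<close> with \<open>g (v @ u) = g v @ h u\<close> for all words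
  \<open>u\<close>; since \<open>g v\<close> has the same length as \<open>v\<close>, it is obtained by removing the first
  \<^term>\<open>length v\<close> letters of \<open>g (v @ u)\<close>. See \<open>tree_section_unique\<close> below.\<close>

definition tree_section :: "'x set \<Rightarrow> ('x list \<Rightarrow> 'x list) \<Rightarrow> 'x list \<Rightarrow> 'x list \<Rightarrow> 'x list" where
  "tree_section X g v = (\<lambda>u\<in>lists X. drop (length v) (g (v @ u)))"

definition level1_aut :: "'x set \<Rightarrow> ('x \<Rightarrow> 'x list \<Rightarrow> 'x list) \<Rightarrow> 'x list \<Rightarrow> 'x list" where
  "level1_aut X h = (\<lambda>w\<in>lists X. case w of [] \<Rightarrow> [] | x # u \<Rightarrow> x # h x u)"

section \<open>Regular branch groups\<close>

definition level_transitive :: "'x set \<Rightarrow> ('x list \<Rightarrow> 'x list) set \<Rightarrow> bool" where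
  "level_transitive X H \<longleftrightarrow> (\<forall>u\<in>lists X. \<forall>v\<in>lists X. length u = length v \<longrightarrow> (\<exists>h\<in>H. h u = v))"

definition finite_index_subgroup :: "('a, 'b) monoid_scheme \<Rightarrow> 'a set \<Rightarrow> 'a set \<Rightarrow> bool" where
  "finite_index_subgroup A K H \<longleftrightarrow>
     subgroup K (A\<lparr>carrier := H\<rparr>) \<and> finite (rcosets\<^bsub>A\<lparr>carrier := H\<rparr>\<^esub> K)"

definition regular_branch_over ::
    "'x set \<Rightarrow> ('x list \<Rightarrow> 'x list) set \<Rightarrow> ('x list \<Rightarrow> 'x list) set \<Rightarrow> bool" where
  "regular_branch_over X H K \<longleftrightarrow>
     subgroup H (tree_Aut X) \<and> level_transitive X H \<and>
     finite_index_subgroup (tree_Aut X) K H \<and>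
     finite_index_subgroup (tree_Aut X) {level1_aut X k | k. \<forall>x\<in>X. k x \<in> K} K"

section \<open>Constant spinal groups\<close>

text \<open>The alphabet is the underlying set \<^term>\<open>carrier R\<close> of the group \<open>R\<close>; the letter attached to a
  group element is the element itself.\<close>

definition rooted_aut :: "('r, 'b) monoid_scheme \<Rightarrow> 'r \<Rightarrow> 'r list \<Rightarrow> 'r list" where
  "rooted_aut R r =
     (\<lambda>w\<in>lists (carrier R). case w of [] \<Rightarrow> [] | s # u \<Rightarrow> (r \<otimes>\<^bsub>R\<^esub> s) # u)"

definition rooted_auts :: "('r, 'b) monoid_scheme \<Rightarrow> ('r list \<Rightarrow> 'r list) set" where
  "rooted_auts R = rooted_aut R ` carrier R"

definition directed_aut :: "('r, 'b) monoid_scheme \<Rightarrow> ('r list \<Rightarrow> 'r list) \<Rightarrow> bool" where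
  "directed_aut R d \<longleftrightarrow>
     d \<in> tree_auts (carrier R) \<and>
     (\<forall>x\<in>carrier R. d [x] = [x]) \<and>
     tree_section (carrier R) d [\<one>\<^bsub>R\<^esub>] = d \<and>
     (\<forall>x\<in>carrier R - {\<one>\<^bsub>R\<^esub>}. tree_section (carrier R) d [x] \<in> rooted_auts R)"

definition Gen :: "('r, 'b) monoid_scheme \<Rightarrow> ('r list \<Rightarrow> 'r list) set \<Rightarrow> bool" where
  "Gen R D \<longleftrightarrow>
     generate (tree_Aut (carrier R))
       {tree_section (carrier R) d [x] | d x. d \<in> D \<and> x \<in> carrier R - {\<one>\<^bsub>R\<^esub>}}
     = rooted_auts R"

definition constant_spinal_data :: "('r, 'b) monoid_scheme \<Rightarrow> ('r list \<Rightarrow> 'r list) set \<Rightarrow> bool" where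
  "constant_spinal_data R D \<longleftrightarrow>
     group R \<and> finite (carrier R) \<and>
     subgroup D (tree_Aut (carrier R)) \<and> (\<forall>d\<in>D. directed_aut R d) \<and> Gen R D"

definition spinal_group ::
    "('r, 'b) monoid_scheme \<Rightarrow> ('r list \<Rightarrow> 'r list) set \<Rightarrow> ('r list \<Rightarrow> 'r list) set" where
  "spinal_group R D = generate (tree_Aut (carrier R)) (rooted_auts R \<union> D)"

section \<open>Basic facts on automorphisms and sections\<close>

lemma tree_auts_lists: "f \<in> tree_auts X \<Longrightarrow> w \<in> lists X \<Longrightarrow> f w \<in> lists X"
  unfolding tree_auts_def by (metis (lifting) Bij_imp_funcset PiE mem_Collect_eq)

lemma tree_auts_inj:
  "f \<in> tree_auts X \<Longrightarrow> u \<in> lists X \<Longrightarrow> v \<in> lists X \<Longrightarrow> f u = f v \<longleftrightarrow> u = v"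
  unfolding tree_auts_def Bij_def bij_betw_def by (auto dest: inj_onD)

lemma tree_auts_surj: "f \<in> tree_auts X \<Longrightarrow> v \<in> lists X \<Longrightarrow> \<exists>u\<in>lists X. f u = v"
proof -
  assume "f \<in> tree_auts X" "v \<in> lists X"
  then have "v \<in> f ` lists X" by (simp add: tree_auts_def Bij_def bij_betw_def)
  then show ?thesis by blast
qed

lemma tree_auts_child:
  assumes f: "f \<in> tree_auts X" and "w \<in> lists X" "x \<in> X"
  shows "\<exists>y\<in>X. f (w @ [x]) = f w @ [y]"
  using assms(2,3)
proof (induction w arbitrary: x rule: rev_induct)
  case Nil
  have "word_adj (f []) (f ([] @ [x]))"
  proof -
    have "word_adj [] ([] @ [x])" by (simp add: word_adj_def)
    moreover have "[] @ [x] \<in> lists X" using Nil by simp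
    ultimately show ?thesis using f unfolding tree_auts_def by blast
  qed
  moreover have "f [] = []" using f by (simp add: tree_auts_def)
  moreover have "f ([] @ [x]) \<in> lists X" using tree_auts_lists[OF f, of "[] @ [x]"] Nil by simp
  ultimately show ?case by (auto simp: word_adj_def)
next
  case (snoc a w)
  have w: "w \<in> lists X" "a \<in> X" "w @ [a] \<in> lists X" "(w @ [a]) @ [x] \<in> lists X"
    using snoc.prems by auto
  then obtain y where y: "f (w @ [a]) = f w @ [y]" using snoc.IH by blast
  have "word_adj (w @ [a]) ((w @ [a]) @ [x])" by (auto simp: word_adj_def)
  then have "word_adj (f (w @ [a])) (f ((w @ [a]) @ [x]))"
    using f w by (simp add: tree_auts_def)
  then consider z where "f ((w @ [a]) @ [x]) = f (w @ [a]) @ [z]"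
    | z where "f (w @ [a]) = f ((w @ [a]) @ [x]) @ [z]"
    unfolding word_adj_def by blast
  then show ?case
  proof cases
    case 1
    moreover have "f ((w @ [a]) @ [x]) \<in> lists X" using f w tree_auts_lists by blast
    ultimately show ?thesis by auto
  next
    case 2
    then have "f ((w @ [a]) @ [x]) = f w" using y by simp
    then show ?thesis using tree_auts_inj[OF f w(4,1)] by simp
  qed
qed

lemma tree_auts_length: "f \<in> tree_auts X \<Longrightarrow> w \<in> lists X \<Longrightarrow> length (f w) = length w"
proof (induction w rule: rev_induct)
  case Nil
  then show ?case by (simp add: tree_auts_def)
next
  case (snoc x w)
  then show ?case using tree_auts_child[of f X w x] by auto
qed

lemma tree_auts_append:
  assumes f: "f \<in> tree_auts X" and "v \<in> lists X" "u \<in> lists X"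
  shows "f (v @ u) = f v @ tree_section X f v u"
proof -
  have "take (length v) (f (v @ u)) = f v"
    using assms(3)
  proof (induction u rule: rev_induct)
    case Nil
    then show ?case using f assms(2) by (simp add: tree_auts_length)
  next
    case (snoc x u)
    then obtain y where "f ((v @ u) @ [x]) = f (v @ u) @ [y]"
      using tree_auts_child[OF f, of "v @ u" x] assms(2) by auto
    moreover have "length (f (v @ u)) = length v + length u"
      using f assms(2) snoc.prems by (simp add: tree_auts_length)
    ultimately show ?case using snoc by simp
  qed
  then show ?thesis
    using assms(3) append_take_drop_id[of "length v" "f (v @ u)"] by (simp add: tree_section_def)
qed

lemma tree_section_in_tree_auts:
  assumes f: "f \<in> tree_auts X" and v: "v \<in> lists X"
  shows "tree_section X f v \<in> tree_auts X"
proof -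
  let ?h = "tree_section X f v"
  have ap: "f (v @ u) = f v @ ?h u" if "u \<in> lists X" for u
    using tree_auts_append[OF f v that] .
  have hX: "?h u \<in> lists X" if "u \<in> lists X" for u
  proof -
    have "f (v @ u) \<in> lists X" using f v that by (simp add: tree_auts_lists del: in_lists_conv_set)
    then show ?thesis using ap[OF that] by simp
  qed
  have inj: "inj_on ?h (lists X)"
  proof (rule inj_onI)
    fix a b assume ab: "a \<in> lists X" "b \<in> lists X" "?h a = ?h b"
    then have "f (v @ a) = f (v @ b)" using ap by simp
    then show "a = b" using tree_auts_inj[OF f, of "v @ a" "v @ b"] v ab by auto
  qed
  have surj: "\<exists>u\<in>lists X. ?h u = t" if t: "t \<in> lists X" for t
  proof -
    have "f v @ t \<in> lists X" using tree_auts_lists[OF f v] t by simp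
    then obtain z where z: "z \<in> lists X" "f z = f v @ t" using tree_auts_surj[OF f] by blast
    let ?p = "take (length v) z" and ?s = "drop (length v) z"
    have ps: "?p \<in> lists X" "?s \<in> lists X" 
      using z(1) by (auto simp: lists_eq_set dest: in_set_takeD in_set_dropD)
    have len: "length z = length v + length t"
      using tree_auts_length[OF f z(1)] tree_auts_length[OF f v] z(2) by simp
    have "f (?p @ ?s) = f ?p @ tree_section X f ?p ?s" using tree_auts_append[OF f ps] .
    moreover have "length (f ?p) = length (f v)"
      using tree_auts_length[OF f ps(1)] tree_auts_length[OF f v] len by simp
    ultimately have "f ?p = f v" using z(2) by simp
    then have "?p = v" using tree_auts_inj[OF f ps(1) v] by simp
    then have "z = v @ ?s" by (metis append_take_drop_id)
    then have "?h ?s = t" using ap[OF ps(2)] z(2) by simp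
    then show ?thesis using ps(2) by blast
  qed
  have "?h ` lists X = lists X" using hX surj by blast
  then have bij: "?h \<in> Bij (lists X)"
    using inj by (simp add: Bij_def bij_betw_def tree_section_def)
  have "f (v @ []) = f v @ ?h []" using ap[of "[]"] by simp
  then have nil: "?h [] = []" by simp
  have shift: "word_adj (p @ a) (p @ b) \<longleftrightarrow> word_adj a b" for p a b :: "'a list"
    by (simp add: word_adj_def)
  have "word_adj (?h a) (?h b) \<longleftrightarrow> word_adj a b" if "a \<in> lists X" "b \<in> lists X" for a b
  proof -
    have "word_adj (?h a) (?h b) \<longleftrightarrow> word_adj (f (v @ a)) (f (v @ b))"
      using ap that by (simp add: shift)
    also have "\<dots> \<longleftrightarrow> word_adj (v @ a) (v @ b)"
      using f v that by (simp add: tree_auts_def)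
    finally show ?thesis by (simp add: shift)
  qed
  then show ?thesis using bij nil by (simp add: tree_auts_def)
qed

lemma tree_section_unique:
  assumes f: "f \<in> tree_auts X" and v: "v \<in> lists X"
  shows "(h \<in> tree_auts X \<and> (\<forall>u\<in>lists X. f (v @ u) = f v @ h u)) \<longleftrightarrow> h = tree_section X f v"
proof
  assume h: "h \<in> tree_auts X \<and> (\<forall>u\<in>lists X. f (v @ u) = f v @ h u)"
  have e: "h \<in> extensional (lists X)" "tree_section X f v \<in> extensional (lists X)"
    using h by (auto simp: tree_auts_def Bij_def tree_section_def)
  show "h = tree_section X f v"
    by (rule extensionalityI[OF e]) (use h tree_auts_append[OF f v] in auto)
next
  assume "h = tree_section X f v"
  then show "h \<in> tree_auts X \<and> (\<forall>u\<in>lists X. f (v @ u) = f v @ h u)"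
    using tree_section_in_tree_auts[OF f v] tree_auts_append[OF f v] by blast
qed

lemma subgroup_tree_auts: "subgroup (tree_auts X) (BijGroup (lists X))"
proof (rule subgroup.intro)
  show "tree_auts X \<subseteq> carrier (BijGroup (lists X))"
    by (auto simp: tree_auts_def BijGroup_def)
next
  fix f g assume f: "f \<in> tree_auts X" and g: "g \<in> tree_auts X"
  have "f \<otimes>\<^bsub>BijGroup (lists X)\<^esub> g = compose (lists X) f g"
    using f g by (simp add: BijGroup_def tree_auts_def)
  moreover have "compose (lists X) f g \<in> Bij (lists X)"
    using f g by (intro compose_Bij) (auto simp: tree_auts_def)
  ultimately show "f \<otimes>\<^bsub>BijGroup (lists X)\<^esub> g \<in> tree_auts X"
    using f g tree_auts_lists[OF g] by (simp add: tree_auts_def compose_def)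
next
  show "\<one>\<^bsub>BijGroup (lists X)\<^esub> \<in> tree_auts X"
    by (simp add: BijGroup_def tree_auts_def id_Bij del: in_lists_conv_set)
next
  fix f assume f: "f \<in> tree_auts X"
  let ?g = "\<lambda>x\<in>lists X. inv_into (lists X) f x"
  have fB: "f \<in> Bij (lists X)" using f by (simp add: tree_auts_def)
  have gB: "?g \<in> Bij (lists X)" using restrict_inv_into_Bij[OF fB] .
  have fg: "?g u \<in> lists X" "f (?g u) = u" if "u \<in> lists X" for u
  proof -
    show "?g u \<in> lists X" using Bij_imp_funcset[OF gB] that by (rule funcset_mem)
    have "u \<in> f ` lists X" using fB that by (simp add: Bij_def bij_betw_def)
    then show "f (?g u) = u" using that by (simp add: f_inv_into_f del: in_lists_conv_set)
  qed
  have nil: "?g [] = []"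
    using fg[of "[]"] tree_auts_inj[OF f, of "?g []" "[]"] f
    by (simp add: tree_auts_def del: in_lists_conv_set)
  have "word_adj (?g u) (?g v) \<longleftrightarrow> word_adj u v" if "u \<in> lists X" "v \<in> lists X" for u v
  proof -
    have "word_adj (f (?g u)) (f (?g v)) \<longleftrightarrow> word_adj (?g u) (?g v)"
      using f fg(1)[OF that(1)] fg(1)[OF that(2)] unfolding tree_auts_def by blast
    then show ?thesis using fg(2)[OF that(1)] fg(2)[OF that(2)] by simp
  qed
  then have "?g \<in> tree_auts X" using gB nil unfolding tree_auts_def by blast
  then show "inv\<^bsub>BijGroup (lists X)\<^esub> f \<in> tree_auts X" using inv_BijGroup[OF fB] by simp
qed

lemma group_tree_Aut: "group (tree_Aut X)"
  unfolding tree_Aut_def by (rule subgroup.subgroup_is_group[OF subgroup_tree_auts group_BijGroup])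

end

theory Submission
  imports Defs "HOL-Algebra.FiniteProduct"
begin

text \<open>Write \<open>g|x\<close> for the section of \<open>g\<close> at a letter \<open>x\<close>. Sections at letters of elements of \<open>G\<close>
  lie in \<open>G\<close>, so by induction on the level it is enough to treat an element \<open>g\<close> whose sections at
  all letters lie in \<open>H\<close>. As \<open>H\<close> is regular branch over \<open>H'\<close>, an automorphism that fixes the
  letters and has all its sections in \<open>H'\<close> belongs to \<open>H' \<subseteq> H\<close>. The aim is therefore to multiply
  \<open>g\<close> by elements of \<open>H\<close> until its sections lie in \<open>H'\<close>; a rooted factor then makes it fix the
  letters.

  Since \<open>H = \<langle>T \<union> R\<rangle>\<close>, every section can be written \<open>t r c\<close> with \<open>t \<in> T\<close>, \<open>r \<in> R\<close> and \<open>c \<in> H'\<close>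
  (\<open>generate_Un_subgroups_decomp\<close>). A directed automorphism is its own section at one letter and
  has rooted sections at all others; hence \<open>t\<inverse>\<close>, multiplied by a rooted automorphism that puts it
  at the right letter, removes \<open>t\<close> from one section and changes the others by rooted factors only
  (\<open>spinal_subgroup_adjust\<close>). This leaves sections of the form \<open>r c\<close>, and what has to be shown is
  \<open>r \<in> R'\<close>.

  That is forced by \<open>g \<in> G\<close>. In a product of rooted and directed automorphisms each directed
  factor \<open>d\<close> contributes \<open>d\<close> itself to one section and the rooted automorphisms \<open>d|z\<close> to the others.
  So, modulo \<open>R'\<close>, the root actions of the sections of \<open>g\<close> are determined by the directed factors
  that occur in these sections (\<open>root_elt_sections\<close>). The factors are counted by
  homomorphisms \<open>\<epsilon>\<^sub>z : G \<rightarrow> R/R'\<close> that are trivial on \<open>R\<close> and send \<open>d \<in> D\<close> to the class of \<open>d|z\<close>.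
  These kill every \<open>r c\<close>, so all root actions of the sections are trivial modulo \<open>R'\<close>
  (\<open>sections_mod_derived\<close>).

  That \<open>\<epsilon>\<^sub>z\<close> is well defined is the main point (\<open>hom_extends_to_G\<close>): every homomorphism from \<open>D\<close> to
  an abelian group extends to \<open>G\<close> trivially on \<open>R\<close>. It certainly extends to the free product of \<open>R\<close>
  and \<open>D\<close>, and one has to see that words representing \<open>1\<close> have value \<open>1\<close>. The sections of a word
  are represented by words that share out its directed letters. Either all of these words have
  fewer directed letters, and induction applies, or a single section receives all directed letters,
  and then the word collapses to a rooted conjugate of one element of \<open>D\<close>.\<close>

section \<open>Groups generated by two subgroups\<close>

text \<open>Every element of the subgroup generated by \<open>A\<close> and \<open>B\<close> arises from \<open>\<one>\<close> by successive left
  multiplications, because \<open>A \<union> B\<close> is closed under inverses.\<close>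

lemma (in group) generate_Un_subgroups_induct [consumes 3, case_names one left right]:
  assumes sub: "subgroup A G" "subgroup B G"
    and g: "g \<in> generate G (A \<union> B)"
    and one: "P \<one>"
    and A: "\<And>a k. \<lbrakk>a \<in> A; k \<in> generate G (A \<union> B); P k\<rbrakk> \<Longrightarrow> P (a \<otimes> k)"
    and B: "\<And>b k. \<lbrakk>b \<in> B; k \<in> generate G (A \<union> B); P k\<rbrakk> \<Longrightarrow> P (b \<otimes> k)"
  shows "P g"
proof -
  have carr: "A \<union> B \<subseteq> carrier G"
    using sub by (simp add: subgroup.subset)
  have *: "\<forall>k\<in>generate G (A \<union> B). P k \<longrightarrow> P (g \<otimes> k)"
    using g
  proof (induction g rule: generate.induct)
    case one
    then show ?case using generate_in_carrier[OF carr] by auto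
  next
    case (incl h)
    then show ?case using A B by blast
  next
    case (inv h)
    then have "inv h \<in> A \<union> B" using sub by (auto intro: subgroup.m_inv_closed)
    then show ?case using A B by blast
  next
    case (eng h1 h2)
    then show ?case
      using generate_in_carrier[OF carr] generate.eng[OF eng(2)] by (auto simp: m_assoc)
  qed
  then have "P (g \<otimes> \<one>)" using one generate.one[of G "A \<union> B"] by blast
  then show ?thesis using generate_in_carrier[OF carr g] by simp
qed

lemma (in group) commutator_in_derived:
  assumes "x \<in> K" "y \<in> K"
  shows "x \<otimes> y \<otimes> inv x \<otimes> inv y \<in> derived G K"
  unfolding derived_def by (rule generate.incl) (use assms in blast)

text \<open>Modulo commutators the letters of a word in \<open>A \<union> B\<close> can be sorted.\<close>

lemma (in group) generate_Un_subgroups_decomp: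
  assumes sub: "subgroup A G" "subgroup B G" and h: "h \<in> generate G (A \<union> B)"
  shows "\<exists>a\<in>A. \<exists>b\<in>B. \<exists>c\<in>derived G (generate G (A \<union> B)). h = a \<otimes> b \<otimes> c"
  using sub h
proof (induction rule: generate_Un_subgroups_induct)
  case one
  have "\<one> \<in> derived G (generate G (A \<union> B))" unfolding derived_def by (rule generate.one)
  then show ?case using sub subgroup.one_closed by force
next
  case (left a' k)
  then obtain a b c where abc: "a \<in> A" "b \<in> B" "c \<in> derived G (generate G (A \<union> B))"
    "k = a \<otimes> b \<otimes> c" by blast
  have carr: "A \<union> B \<subseteq> carrier G" using sub by (simp add: subgroup.subset)
  have "c \<in> carrier G" using derived_in_carrier[OF generate_incl[OF carr]] abc by blast
  moreover have "a' \<in> carrier G" "a \<in> carrier G" "b \<in> carrier G"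
    using abc left carr by blast+
  ultimately have "a' \<otimes> k = (a' \<otimes> a) \<otimes> b \<otimes> c"
    by (simp add: abc(4) m_assoc)
  then show ?case using abc left sub subgroup.m_closed by metis
next
  case (right b' k)
  then obtain a b c where abc: "a \<in> A" "b \<in> B" "c \<in> derived G (generate G (A \<union> B))"
    "k = a \<otimes> b \<otimes> c" by blast
  let ?K = "generate G (A \<union> B)"
  have carr: "A \<union> B \<subseteq> carrier G" using sub by (simp add: subgroup.subset)
  have K: "?K \<subseteq> carrier G" by (rule generate_incl[OF carr])
  have c: "c \<in> carrier G" using derived_in_carrier[OF K] abc by blast
  define u where "u = b' \<otimes> b"
  have u: "u \<in> B" using right abc sub by (simp add: u_def subgroup.m_closed)
  have mem: "inv u \<in> ?K" "inv a \<in> ?K" "inv b \<in> ?K" "u \<in> ?K" "a \<in> ?K" "b \<in> ?K"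
    using abc u by (auto intro: generate.intros)
  then have carr': "u \<in> carrier G" "a \<in> carrier G" "b \<in> carrier G" "b' \<in> carrier G"
    using K carr right by auto
  \<comment> \<open>\<open>b' a b = a u (u\<inverse> a\<inverse> b' a b)\<close>, and with \<open>b' = u b\<inverse>\<close> the last factor is
     \<open>[u\<inverse>, a\<inverse>] [a\<inverse>, b\<inverse>]\<close>.\<close>
  define c' where "c' = (inv u \<otimes> inv a \<otimes> inv (inv u) \<otimes> inv (inv a)) \<otimes>
    (inv a \<otimes> inv b \<otimes> inv (inv a) \<otimes> inv (inv b))"
  have "c' \<in> derived G ?K"
    unfolding c'_def
    by (intro subgroup.m_closed[OF derived_is_subgroup[OF K]] commutator_in_derived mem)
  then have cc: "c' \<otimes> c \<in> derived G ?K"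
    using abc(3) by (intro subgroup.m_closed[OF derived_is_subgroup[OF K]])
  have b': "b' = u \<otimes> inv b" using carr' by (simp add: u_def m_assoc)
  have cancel: "x \<otimes> (inv x \<otimes> y) = y" "inv x \<otimes> (x \<otimes> y) = y"
    if "x \<in> carrier G" "y \<in> carrier G" for x y
    using that by (simp_all add: m_assoc[symmetric])
  have "a \<otimes> u \<otimes> c' = b' \<otimes> (a \<otimes> b)"
    unfolding c'_def b' using carr' by (simp add: m_assoc cancel)
  moreover have "c' \<in> carrier G"
    using derived_in_carrier[OF K] \<open>c' \<in> derived G ?K\<close> by blast
  moreover have "b' \<otimes> k = b' \<otimes> (a \<otimes> b) \<otimes> c"
    using carr' c by (simp add: abc(4) m_assoc)
  ultimately have "b' \<otimes> k = a \<otimes> u \<otimes> (c' \<otimes> c)"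
    using m_assoc[of "a \<otimes> u" c' c] carr' c by simp
  then show ?case using abc(1) u cc by blast
qed

lemma (in group_hom) hom_comm_group_derived:
  assumes "comm_group H" "K \<subseteq> carrier G" "c \<in> derived G K"
  shows "h c = \<one>\<^bsub>H\<^esub>"
proof -
  have "derived H (h ` K) = {\<one>\<^bsub>H\<^esub>}"
    by (rule comm_group.derived_eq_singleton) (use assms in auto)
  then show ?thesis using derived_img[OF assms(2)] assms(3) by blast
qed

section \<open>Sections of products\<close>

lemma carrier_tree_Aut [simp]: "carrier (tree_Aut X) = tree_auts X"
  by (simp add: tree_Aut_def)

lemma tree_Aut_mult_apply:
  assumes "f \<in> tree_auts X" "g \<in> tree_auts X" "w \<in> lists X"
  shows "(f \<otimes>\<^bsub>tree_Aut X\<^esub> g) w = f (g w)"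
  using assms by (simp add: tree_Aut_def BijGroup_def tree_auts_def compose_eq del: in_lists_conv_set)

lemma tree_Aut_one_apply: "w \<in> lists X \<Longrightarrow> \<one>\<^bsub>tree_Aut X\<^esub> w = w"
  by (simp add: tree_Aut_def BijGroup_def del: in_lists_conv_set)

lemma tree_Aut_one_closed [simp]: "\<one>\<^bsub>tree_Aut X\<^esub> \<in> tree_auts X"
  using monoid.one_closed[OF group.is_monoid[OF group_tree_Aut]] by fastforce

lemma tree_Aut_mult_closed [simp]:
  "f \<in> tree_auts X \<Longrightarrow> g \<in> tree_auts X \<Longrightarrow> f \<otimes>\<^bsub>tree_Aut X\<^esub> g \<in> tree_auts X"
  using monoid.m_closed[OF group.is_monoid[OF group_tree_Aut]] by fastforce

lemma tree_auts_eqI: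
  assumes "f \<in> tree_auts X" "g \<in> tree_auts X" "\<And>w. w \<in> lists X \<Longrightarrow> f w = g w"
  shows "f = g"
  by (rule extensionalityI[of _ "lists X"]) (use assms in \<open>auto simp: tree_auts_def Bij_def\<close>)

lemma tree_section_eqI:
  assumes "f \<in> tree_auts X" "v \<in> lists X" "h \<in> tree_auts X"
    and "\<And>u. u \<in> lists X \<Longrightarrow> f (v @ u) = f v @ h u"
  shows "tree_section X f v = h"
  using tree_section_unique[OF assms(1,2), of h] assms(3,4) by blast

text \<open>The cocycle rule for sections, by which all sections below are computed.\<close>

lemma tree_section_mult:
  assumes f: "f \<in> tree_auts X" and g: "g \<in> tree_auts X" and v: "v \<in> lists X"
  shows "tree_section X (f \<otimes>\<^bsub>tree_Aut X\<^esub> g) v =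
    tree_section X f (g v) \<otimes>\<^bsub>tree_Aut X\<^esub> tree_section X g v"
proof -
  have gv: "g v \<in> lists X" using tree_auts_lists[OF g v] .
  have s: "tree_section X f (g v) \<in> tree_auts X" "tree_section X g v \<in> tree_auts X"
    using tree_section_in_tree_auts f g v gv by blast+
  have "(f \<otimes>\<^bsub>tree_Aut X\<^esub> g) (v @ u) = (f \<otimes>\<^bsub>tree_Aut X\<^esub> g) v @
    (tree_section X f (g v) \<otimes>\<^bsub>tree_Aut X\<^esub> tree_section X g v) u" if u: "u \<in> lists X" for u
  proof -
    have vu: "v @ u \<in> lists X" using v u by simp
    have "tree_section X g v u \<in> lists X" using tree_auts_lists[OF s(2) u] .
    then show ?thesis
      using tree_Aut_mult_apply[OF f g vu] tree_Aut_mult_apply[OF f g v] tree_Aut_mult_apply[OF s u]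
        tree_auts_append[OF g v u] tree_auts_append[OF f gv] by simp
  qed
  then show ?thesis
    by (intro tree_section_eqI tree_Aut_mult_closed f g v s)
qed

lemma tree_section_one:
  assumes "v \<in> lists X"
  shows "tree_section X \<one>\<^bsub>tree_Aut X\<^esub> v = \<one>\<^bsub>tree_Aut X\<^esub>"
  using assms by (intro tree_section_eqI) (simp_all add: tree_Aut_one_apply)

lemma tree_section_Nil: "f \<in> tree_auts X \<Longrightarrow> tree_section X f [] = f"
  by (rule tree_section_eqI) (auto simp: tree_auts_def)

lemma tree_section_section_singleton:
  assumes "x \<in> X" "u \<in> lists X"
  shows "tree_section X (tree_section X f [x]) u = tree_section X f (x # u)"
  unfolding tree_section_def using assms
  by (auto simp: restrict_def fun_eq_iff drop_Suc tl_drop)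

text \<open>This puts an automorphism into the form in which the regular branch condition speaks of it.\<close>

lemma level1_aut_sections:
  assumes f: "f \<in> tree_auts X" and fix1: "\<And>x. x \<in> X \<Longrightarrow> f [x] = [x]"
  shows "f = level1_aut X (\<lambda>x. tree_section X f [x])"
proof (rule extensionalityI[of _ "lists X"])
  show "f \<in> extensional (lists X)" using f by (simp add: tree_auts_def Bij_def)
  show "level1_aut X (\<lambda>x. tree_section X f [x]) \<in> extensional (lists X)"
    by (simp add: level1_aut_def)
  fix w assume w: "w \<in> lists X"
  show "f w = level1_aut X (\<lambda>x. tree_section X f [x]) w"
  proof (cases w)
    case Nil
    then show ?thesis using f by (simp add: level1_aut_def tree_auts_def)
  next
    case (Cons x u)
    then show ?thesis
      using w tree_auts_append[OF f, of "[x]" u] fix1[of x] by (simp add: level1_aut_def)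
  qed
qed


section \<open>Rooted automorphisms\<close>

text \<open>What depends on the alphabet only is kept in a locale of its own, so that the spinal groups of
  several groups of directed automorphisms share one set of notations.\<close>

locale group_alphabet = group R for R :: "('r, 'b) monoid_scheme" (structure)
begin

abbreviation X where "X \<equiv> carrier R"
abbreviation aut_mult (infixl "\<star>" 70) where "f \<star> g \<equiv> f \<otimes>\<^bsub>tree_Aut X\<^esub> g"
abbreviation sec where "sec g x \<equiv> tree_section X g [x]"
abbreviation rooted where "rooted \<equiv> rooted_aut R"

text \<open>For an automorphism that acts on the letters by left multiplication with a group element this
  is that element; the letter \<open>\<one>\<close> reveals it.\<close>

definition root_elt :: "('r list \<Rightarrow> 'r list) \<Rightarrow> 'r" where
  "root_elt g = hd (g [\<one>])"

end

sublocale group_alphabet \<subseteq> Aut: group "tree_Aut X"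
  by (rule group_tree_Aut)

context group_alphabet
begin

lemma rooted_Cons: "s \<in> X \<Longrightarrow> u \<in> lists X \<Longrightarrow> rooted r (s # u) = (r \<otimes> s) # u"
  by (simp add: rooted_aut_def)

lemma rooted_Nil: "rooted r [] = []"
  by (simp add: rooted_aut_def)

lemma rooted_closed: "r \<in> X \<Longrightarrow> w \<in> lists X \<Longrightarrow> rooted r w \<in> lists X"
  by (cases w) (simp_all add: rooted_Cons rooted_Nil)

lemma rooted_rooted:
  assumes "r \<in> X" "s \<in> X" "w \<in> lists X"
  shows "rooted r (rooted s w) = rooted (r \<otimes> s) w"
  using assms by (cases w) (simp_all add: rooted_Cons rooted_Nil m_assoc)

lemma rooted_one: "w \<in> lists X \<Longrightarrow> rooted \<one> w = w"
  by (cases w) (simp_all add: rooted_Cons rooted_Nil)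

lemma rooted_in_tree_auts:
  assumes r: "r \<in> X"
  shows "rooted r \<in> tree_auts X"
proof -
  have img: "rooted s ` lists X \<subseteq> lists X" if "s \<in> X" for s
    using rooted_closed[OF that] by blast
  have bij: "bij_betw (rooted r) (lists X) (lists X)"
    by (rule bij_betw_byWitness[where f' = "rooted (inv r)", OF _ _ img img])
      (simp_all add: r rooted_rooted rooted_one del: in_lists_conv_set)
  have adj1: "word_adj (rooted s u) (rooted s v)"
    if s: "s \<in> X" and u: "u \<in> lists X" "v \<in> lists X" and a: "word_adj u v" for s u v
  proof -
    have *: "\<exists>y. rooted s (w @ [x]) = rooted s w @ [y]" if "w \<in> lists X" "x \<in> X" for w x
      using that s by (cases w) (auto simp: rooted_Cons rooted_Nil)
    from a consider x where "v = u @ [x]" | x where "u = v @ [x]"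
      unfolding word_adj_def by blast
    then show ?thesis
    proof cases
      case 1
      then have "\<exists>y. rooted s v = rooted s u @ [y]" using *[of u x] u by auto
      then show ?thesis by (auto simp: word_adj_def)
    next
      case 2
      then have "\<exists>y. rooted s u = rooted s v @ [y]" using *[of v x] u by auto
      then show ?thesis by (auto simp: word_adj_def)
    qed
  qed
  have "word_adj (rooted r u) (rooted r v) \<longleftrightarrow> word_adj u v"
    if u: "u \<in> lists X" "v \<in> lists X" for u v
    using adj1[OF r u] adj1[OF inv_closed[OF r] rooted_closed[OF r u(1)] rooted_closed[OF r u(2)]]
      r u by (auto simp: rooted_rooted rooted_one simp del: in_lists_conv_set)
  then show ?thesis
    using bij by (auto simp: tree_auts_def Bij_def rooted_Nil rooted_aut_def)
qed

lemma rooted_mult: "r \<in> X \<Longrightarrow> s \<in> X \<Longrightarrow> rooted (r \<otimes> s) = rooted r \<star> rooted s"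
  by (rule tree_auts_eqI[of _ X])
    (auto simp: rooted_in_tree_auts tree_Aut_mult_apply rooted_rooted tree_Aut_mult_closed
      simp del: in_lists_conv_set)

lemma rooted_one_eq: "rooted \<one> = \<one>\<^bsub>tree_Aut X\<^esub>"
  by (intro tree_auts_eqI[of _ X]) (simp_all add: rooted_in_tree_auts rooted_one tree_Aut_one_apply)

lemma rooted_group_hom: "group_hom R (tree_Aut X) rooted"
  by unfold_locales (auto simp: hom_def rooted_in_tree_auts rooted_mult)

lemma subgroup_rooted_auts: "subgroup (rooted_auts R) (tree_Aut X)"
  unfolding rooted_auts_def
  by (rule group_hom.subgroup_img_is_subgroup[OF rooted_group_hom subgroup_self])

lemma sec_rooted:
  assumes "r \<in> X" "x \<in> X"
  shows "sec (rooted r) x = \<one>\<^bsub>tree_Aut X\<^esub>"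
  using assms
  by (intro tree_section_eqI) (simp_all add: rooted_in_tree_auts rooted_Cons tree_Aut_one_apply)

lemma root_elt_rooted: "r \<in> X \<Longrightarrow> root_elt (rooted r) = r"
  by (simp add: root_elt_def rooted_Cons)

lemma root_elt_one: "root_elt \<one>\<^bsub>tree_Aut X\<^esub> = \<one>"
  by (simp add: root_elt_def tree_Aut_one_apply)

lemma sec_one: "x \<in> X \<Longrightarrow> sec \<one>\<^bsub>tree_Aut X\<^esub> x = \<one>\<^bsub>tree_Aut X\<^esub>"
  by (simp add: tree_section_one)

end

section \<open>The root action of a constant spinal group\<close>

locale constant_spinal =
  fixes R :: "('r, 'b) monoid_scheme" (structure) and D :: "('r list \<Rightarrow> 'r list) set"
  assumes data: "constant_spinal_data R D"

sublocale constant_spinal \<subseteq> group_alphabet R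
  using data by (simp add: constant_spinal_data_def group_alphabet_def)

context constant_spinal
begin

abbreviation G where "G \<equiv> spinal_group R D"

lemma finite_X: "finite X"
  using data by (simp add: constant_spinal_data_def)

lemma subgroup_D: "subgroup D (tree_Aut X)"
  using data by (simp add: constant_spinal_data_def)

lemma D_directed: "d \<in> D \<Longrightarrow> directed_aut R d"
  using data by (simp add: constant_spinal_data_def)

lemma D_tree_auts: "d \<in> D \<Longrightarrow> d \<in> tree_auts X"
  using D_directed by (simp add: directed_aut_def)

lemma D_fix: "d \<in> D \<Longrightarrow> x \<in> X \<Longrightarrow> d [x] = [x]"
  using D_directed by (simp add: directed_aut_def)

lemma sec_D_one: "d \<in> D \<Longrightarrow> sec d \<one> = d"
  using D_directed by (simp add: directed_aut_def)

lemma sec_D: "d \<in> D \<Longrightarrow> x \<in> X \<Longrightarrow> x \<noteq> \<one> \<Longrightarrow> \<exists>r\<in>X. sec d x = rooted r"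
  using D_directed[of d] unfolding directed_aut_def rooted_auts_def by blast

lemma subgroup_G: "subgroup G (tree_Aut X)"
  unfolding spinal_group_def
  by (rule Aut.generate_is_subgroup)
    (use subgroup_rooted_auts subgroup_D in \<open>simp add: subgroup_def\<close>)

lemma G_tree_auts: "g \<in> G \<Longrightarrow> g \<in> tree_auts X"
  using subgroup.subset[OF subgroup_G] by auto

lemma D_in_G: "d \<in> D \<Longrightarrow> d \<in> G"
  unfolding spinal_group_def by (simp add: generate.incl)

lemma rooted_in_G: "r \<in> X \<Longrightarrow> rooted r \<in> G"
  unfolding spinal_group_def rooted_auts_def by (simp add: generate.incl)

lemma G_mult: "g \<in> G \<Longrightarrow> h \<in> G \<Longrightarrow> g \<star> h \<in> G"
  using subgroup_G by (rule subgroup.m_closed)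

lemma G_induct [consumes 1, case_names one rooted directed]:
  assumes "g \<in> G"
    and "P \<one>\<^bsub>tree_Aut X\<^esub>"
    and "\<And>r k. \<lbrakk>r \<in> X; k \<in> G; P k\<rbrakk> \<Longrightarrow> P (rooted r \<star> k)"
    and "\<And>d k. \<lbrakk>d \<in> D; k \<in> G; P k\<rbrakk> \<Longrightarrow> P (d \<star> k)"
  shows "P g"
  using Aut.generate_Un_subgroups_induct[OF subgroup_rooted_auts subgroup_D, of g P] assms
  unfolding spinal_group_def rooted_auts_def by blast

text \<open>Directed automorphisms fix the letters, so every element of \<open>G\<close> acts on them through \<open>R\<close>.
  Thus \<^term>\<open>root_elt\<close> is the homomorphism \<open>G \<rightarrow> R\<close> with kernel the stabiliser of the first
  level.\<close>

lemma G_acts_at_root: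
  assumes "g \<in> G"
  shows "root_elt g \<in> X \<and> (\<forall>x\<in>X. g [x] = [root_elt g \<otimes> x])"
  using assms
proof (induction rule: G_induct)
  case one
  then show ?case by (simp add: root_elt_def tree_Aut_one_apply)
next
  case (rooted r k)
  then have "(rooted r \<star> k) [x] = [r \<otimes> root_elt k \<otimes> x]" if "x \<in> X" for x
    using that by (simp add: tree_Aut_mult_apply rooted_in_tree_auts G_tree_auts rooted_Cons m_assoc)
  then show ?case using rooted by (simp add: root_elt_def[of "rooted r \<star> k"])
next
  case (directed d k)
  then have "(d \<star> k) [x] = [root_elt k \<otimes> x]" if "x \<in> X" for x
    using that by (simp add: tree_Aut_mult_apply D_tree_auts G_tree_auts D_fix)
  then show ?case using directed by (simp add: root_elt_def[of "d \<star> k"])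
qed

lemma root_elt_closed: "g \<in> G \<Longrightarrow> root_elt g \<in> X"
  using G_acts_at_root by blast

lemma G_letter: "g \<in> G \<Longrightarrow> x \<in> X \<Longrightarrow> g [x] = [root_elt g \<otimes> x]"
  using G_acts_at_root by blast

lemma root_elt_mult:
  assumes "g \<in> G" "h \<in> G"
  shows "root_elt (g \<star> h) = root_elt g \<otimes> root_elt h"
  unfolding root_elt_def[of "g \<star> h"]
  using assms by (simp add: tree_Aut_mult_apply G_tree_auts G_letter root_elt_closed)

lemma root_elt_D: "d \<in> D \<Longrightarrow> root_elt d = \<one>"
  by (simp add: root_elt_def D_fix)

lemma sec_mult:
  assumes "g \<in> G" "h \<in> G" "x \<in> X"
  shows "sec (g \<star> h) x = sec g (root_elt h \<otimes> x) \<star> sec h x"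
  using assms by (simp add: tree_section_mult G_tree_auts G_letter)

lemma sec_tree_auts: "g \<in> G \<Longrightarrow> x \<in> X \<Longrightarrow> sec g x \<in> tree_auts X"
  by (simp add: tree_section_in_tree_auts G_tree_auts)

lemma sec_rooted_mult: "r \<in> X \<Longrightarrow> h \<in> G \<Longrightarrow> x \<in> X \<Longrightarrow> sec (rooted r \<star> h) x = sec h x"
  by (simp add: sec_mult rooted_in_G sec_rooted root_elt_closed sec_tree_auts)

lemma sec_D_in_G: "d \<in> D \<Longrightarrow> x \<in> X \<Longrightarrow> sec d x \<in> G"
  using sec_D[of d x] sec_D_one[of d] by (cases "x = \<one>") (auto simp: D_in_G rooted_in_G)

text \<open>The group is self-similar, since it contains all sections of its generators.\<close>

lemma sec_in_G:
  assumes "g \<in> G" "x \<in> X"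
  shows "sec g x \<in> G"
  using assms
proof (induction rule: G_induct)
  case one
  then show ?case using subgroup.one_closed[OF subgroup_G] by (simp add: sec_one)
next
  case (rooted r k)
  then show ?case by (simp add: sec_rooted_mult)
next
  case (directed d k)
  then show ?case by (simp add: sec_mult D_in_G G_mult sec_D_in_G root_elt_closed)
qed

end


section \<open>Homomorphisms to abelian groups\<close>

text \<open>A homomorphism \<open>\<phi>\<close> from \<open>D\<close> to an abelian group is extended to \<open>G\<close>.\<close>

locale constant_spinal_hom = constant_spinal R D + A: comm_group A
  for R :: "('r, 'b) monoid_scheme" (structure) and D and A :: "('a, 'c) monoid_scheme" +
  fixes \<phi> :: "('r list \<Rightarrow> 'r list) \<Rightarrow> 'a"
  assumes hom_\<phi>: "\<phi> \<in> hom (tree_Aut (carrier R)\<lparr>carrier := D\<rparr>) A"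
begin

text \<open>The triple \<open>(g, n, a)\<close> records that some word in \<open>R\<close> and \<open>D\<close> represents \<open>g\<close>, has \<open>n\<close> letters in
  \<open>D\<close>, and is mapped to \<open>a\<close> by the homomorphism from the free product of \<open>R\<close> and \<open>D\<close> that is trivial
  on \<open>R\<close> and \<open>\<phi>\<close> on \<open>D\<close>. The length \<open>n\<close> is what the contraction argument below inducts on.\<close>

inductive word_value :: "('r list \<Rightarrow> 'r list) \<Rightarrow> nat \<Rightarrow> 'a \<Rightarrow> bool" where
  one: "word_value \<one>\<^bsub>tree_Aut X\<^esub> 0 \<one>\<^bsub>A\<^esub>"
| rooted: "r \<in> X \<Longrightarrow> word_value g n a \<Longrightarrow> word_value (rooted r \<star> g) n a"
| directed: "d \<in> D \<Longrightarrow> word_value g n a \<Longrightarrow> word_value (d \<star> g) (Suc n) (\<phi> d \<otimes>\<^bsub>A\<^esub> a)"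

lemma \<phi>_closed: "d \<in> D \<Longrightarrow> \<phi> d \<in> carrier A"
  using hom_\<phi> by (auto simp: hom_def)

lemma \<phi>_mult: "d \<in> D \<Longrightarrow> d' \<in> D \<Longrightarrow> \<phi> (d \<star> d') = \<phi> d \<otimes>\<^bsub>A\<^esub> \<phi> d'"
  using hom_\<phi> by (auto simp: hom_def)

lemma \<phi>_one: "\<phi> \<one>\<^bsub>tree_Aut X\<^esub> = \<one>\<^bsub>A\<^esub>"
proof -
  have 1: "\<one>\<^bsub>tree_Aut X\<^esub> \<in> D" using subgroup_D by (rule subgroup.one_closed)
  then have "\<phi> \<one>\<^bsub>tree_Aut X\<^esub> \<otimes>\<^bsub>A\<^esub> \<phi> \<one>\<^bsub>tree_Aut X\<^esub> = \<phi> \<one>\<^bsub>tree_Aut X\<^esub>"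
    using \<phi>_mult[OF 1 1] by simp
  then show ?thesis
    using A.l_cancel_one[OF \<phi>_closed[OF 1] \<phi>_closed[OF 1]] by simp
qed

lemma word_value_closed: "word_value g n a \<Longrightarrow> g \<in> G \<and> a \<in> carrier A"
proof (induction rule: word_value.induct)
  case one
  then show ?case using subgroup.one_closed[OF subgroup_G] by simp
qed (auto intro: G_mult rooted_in_G D_in_G \<phi>_closed)

lemma word_value_mult:
  assumes "word_value g n a" "word_value h m b"
  shows "word_value (g \<star> h) (n + m) (a \<otimes>\<^bsub>A\<^esub> b)"
  using assms
proof (induction rule: word_value.induct)
  case one
  then show ?case using word_value_closed[of h m b] by (simp add: G_tree_auts)
next
  case (rooted r g n a)
  then show ?case
    using word_value.rooted[OF rooted(1,3)] word_value_closed[OF rooted(2)]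
      word_value_closed[OF assms(2)]
    by (simp add: Aut.m_assoc G_tree_auts rooted_in_tree_auts)
next
  case (directed d g n a)
  then show ?case
    using word_value.directed[OF directed(1,3)] word_value_closed[OF directed(2)]
      word_value_closed[OF assms(2)]
    by (simp add: Aut.m_assoc A.m_assoc G_tree_auts D_tree_auts \<phi>_closed)
qed

lemma word_value_rooted: "r \<in> X \<Longrightarrow> word_value (rooted r) 0 \<one>\<^bsub>A\<^esub>"
  using word_value.rooted[OF _ word_value.one, of r] by (simp add: rooted_in_tree_auts)

lemma word_value_directed: "d \<in> D \<Longrightarrow> word_value d (Suc 0) (\<phi> d)"
  using word_value.directed[OF _ word_value.one, of d] by (simp add: D_tree_auts \<phi>_closed)

lemma word_value_total: "g \<in> G \<Longrightarrow> \<exists>n a. word_value g n a"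
  by (induction rule: G_induct) (use word_value.intros in blast)+

text \<open>Each directed letter of a word for \<open>g\<close> passes to the section at exactly one letter \<open>x\<close>, namely
  the one that the part of the word to its right moves to \<open>\<one>\<close>, and leaves rooted letters in all other
  sections. So the values of the sections multiply to the value of the word, and no section gets
  longer. If the section at \<open>x\<close> is as long as the word, then all directed letters have met \<open>x\<close> at
  \<open>\<one>\<close>; the rooted parts between them fix \<open>\<one>\<close>, hence are trivial, and the directed letters merge
  into one.\<close>

lemma word_value_sections:
  assumes "word_value g n a"
  shows "\<exists>m b. (\<forall>x\<in>X. word_value (sec g x) (m x) (b x) \<and> m x \<le> n) \<and> a = finprod A b X \<and>
    (\<forall>x\<in>X. m x = n \<longrightarrow>
      (\<exists>r\<in>X. \<exists>d\<in>D. \<exists>s\<in>X. s \<otimes> x = \<one> \<and> g = rooted r \<star> (d \<star> rooted s) \<and> \<phi> d = a))"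
    (is "\<exists>m b. ?P g n a m b")
  using assms
proof (induction rule: word_value.induct)
  case one
  have 1: "\<one>\<^bsub>tree_Aut X\<^esub> \<in> D" using subgroup_D by (rule subgroup.one_closed)
  have "\<exists>r\<in>X. \<exists>d\<in>D. \<exists>s\<in>X. s \<otimes> x = \<one> \<and>
      \<one>\<^bsub>tree_Aut X\<^esub> = rooted r \<star> (d \<star> rooted s) \<and> \<phi> d = \<one>\<^bsub>A\<^esub>" if x: "x \<in> X" for x
    by (intro bexI[of _ x] bexI[of _ "\<one>\<^bsub>tree_Aut X\<^esub>"] bexI[of _ "inv x"])
      (use 1 x in \<open>simp_all add: \<phi>_one rooted_in_tree_auts rooted_mult[symmetric] rooted_one_eq\<close>)
  then have "?P \<one>\<^bsub>tree_Aut X\<^esub> 0 \<one>\<^bsub>A\<^esub> (\<lambda>_. 0) (\<lambda>_. \<one>\<^bsub>A\<^esub>)"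
    using word_value.one by (simp add: sec_one)
  then show ?case by (intro exI[of _ "\<lambda>_. 0"] exI[of _ "\<lambda>_. \<one>\<^bsub>A\<^esub>"])
next
  case (rooted r g n a)
  then obtain m b where IH: "?P g n a m b" by blast
  have g: "g \<in> G" using rooted word_value_closed by blast
  have "\<exists>r\<in>X. \<exists>d\<in>D. \<exists>s\<in>X. s \<otimes> x = \<one> \<and>
      rooted_aut R r' \<star> g = rooted_aut R r \<star> (d \<star> rooted_aut R s) \<and> \<phi> d = a"
    if x: "x \<in> X" "m x = n" and r': "r' \<in> X" for x r'
  proof -
    obtain r'' d s where *: "r'' \<in> X" "d \<in> D" "s \<in> X" "s \<otimes> x = \<one>"
      "g = rooted_aut R r'' \<star> (d \<star> rooted_aut R s)" "\<phi> d = a" using IH x by blast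
    then have "rooted_aut R r' \<star> g = rooted_aut R (r' \<otimes> r'') \<star> (d \<star> rooted_aut R s)"
      using r' by (simp add: rooted_mult rooted_in_tree_auts D_tree_auts tree_Aut_mult_closed Aut.m_assoc)
    then show ?thesis
      using *(2,3,4,6) r' by (intro bexI[of _ "r' \<otimes> r''"] bexI[of _ d] bexI[of _ s]) (simp_all add: *(1))
  qed
  then have "?P (rooted_aut R r \<star> g) n a m b"
    using IH rooted.hyps g by (simp add: sec_rooted_mult)
  then show ?case by (intro exI[of _ m] exI[of _ b])
next
  case (directed d g n a)
  then obtain m b where IH: "?P g n a m b" by blast
  have g: "g \<in> G" and a: "a \<in> carrier A" using directed word_value_closed by blast+
  note d = directed.hyps(1)
  \<comment> \<open>The letter that \<open>g\<close> moves to \<open>\<one>\<close>.\<close>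
  define y where "y = inv (root_elt g)"
  have y: "y \<in> X" using g by (simp add: y_def root_elt_closed)
  have y1: "root_elt g \<otimes> x = \<one> \<longleftrightarrow> x = y" if "x \<in> X" for x
    using inv_unique'[of "root_elt g" x] inv_comm[of "root_elt g" x] r_inv[of "root_elt g"]
      root_elt_closed[OF g] that by (auto simp: y_def)
  define m' b' where "m' = (\<lambda>x. if x = y then Suc (m x) else m x)"
    and "b' = (\<lambda>x. (if x = y then \<phi> d else \<one>\<^bsub>A\<^esub>) \<otimes>\<^bsub>A\<^esub> b x)"
  have b: "b \<in> X \<rightarrow> carrier A" using IH word_value_closed by blast
  have "finprod A b' X = finprod A (\<lambda>x. if x = y then \<phi> d else \<one>\<^bsub>A\<^esub>) X \<otimes>\<^bsub>A\<^esub> finprod A b X"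
    unfolding b'_def by (rule A.finprod_multf) (use d b \<phi>_closed in auto)
  also have "finprod A (\<lambda>x. if x = y then \<phi> d else \<one>\<^bsub>A\<^esub>) X = \<phi> d"
    by (rule A.finprod_singleton_swap[OF y finite_X, of "\<lambda>_. \<phi> d"]) (simp add: \<phi>_closed d)
  finally have prod: "\<phi> d \<otimes>\<^bsub>A\<^esub> a = finprod A b' X" using IH by simp
  have secs: "word_value (sec (d \<star> g) x) (m' x) (b' x) \<and> m' x \<le> Suc n" if x: "x \<in> X" for x
  proof (cases "x = y")
    case True
    then have "sec (d \<star> g) x = d \<star> sec g x"
      using x d g y1[OF x] by (simp add: sec_mult D_in_G sec_D_one)
    moreover have "word_value (d \<star> sec g x) (Suc (m x)) (\<phi> d \<otimes>\<^bsub>A\<^esub> b x)" "m x \<le> n"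
      using IH x d by (blast intro: word_value.directed)+
    ultimately show ?thesis
      using True by (simp add: m'_def b'_def)
  next
    case False
    then obtain r where "r \<in> X" "sec d (root_elt g \<otimes> x) = rooted_aut R r"
      using sec_D[OF d, of "root_elt g \<otimes> x"] g x y1[OF x] root_elt_closed by auto
    then have "sec (d \<star> g) x = rooted_aut R r \<star> sec g x" "r \<in> X"
      using x d g by (simp_all add: sec_mult D_in_G)
    moreover from this(2) have "word_value (rooted_aut R r \<star> sec g x) (m x) (b x)" "m x \<le> n"
      using IH x by (blast intro: word_value.rooted)+
    moreover have "b x \<in> carrier A" using b x by blast
    ultimately show ?thesis
      using False by (simp add: m'_def b'_def)
  qed
  have conc: "\<exists>r\<in>X. \<exists>e\<in>D. \<exists>s\<in>X. s \<otimes> x = \<one> \<and>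
      d \<star> g = rooted_aut R r \<star> (e \<star> rooted_aut R s) \<and> \<phi> e = \<phi> d \<otimes>\<^bsub>A\<^esub> a"
    if x: "x \<in> X" "m' x = Suc n" for x
  proof -
    have xy: "x = y" and mn: "m x = n"
      using x IH by (force simp: m'_def split: if_splits)+
    then obtain r e s where *: "r \<in> X" "e \<in> D" "s \<in> X" "s \<otimes> x = \<one>"
      "g = rooted_aut R r \<star> (e \<star> rooted_aut R s)" "\<phi> e = a" using IH x by blast
    have "root_elt g = r \<otimes> s"
      unfolding *(5) using *(1-3)
      by (simp add: root_elt_mult rooted_in_G D_in_G G_mult root_elt_rooted root_elt_D)
    then have "r \<otimes> (s \<otimes> x) = \<one>" using y1[OF x(1)] xy * x by (simp add: m_assoc)
    then have "r = \<one>" using * by simp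
    then have "d \<star> g = rooted_aut R \<one> \<star> ((d \<star> e) \<star> rooted_aut R s)"
      unfolding *(5) using *(2,3) d
      by (simp add: rooted_one_eq rooted_in_tree_auts D_tree_auts tree_Aut_mult_closed Aut.m_assoc)
    moreover have "d \<star> e \<in> D" using subgroup.m_closed[OF subgroup_D d *(2)] .
    moreover have "\<phi> (d \<star> e) = \<phi> d \<otimes>\<^bsub>A\<^esub> a" using \<phi>_mult d * by simp
    ultimately show ?thesis
      using *(3,4) by (intro bexI[of _ \<one>] bexI[of _ "d \<star> e"] bexI[of _ s]) simp_all
  qed
  then have "?P (d \<star> g) (Suc n) (\<phi> d \<otimes>\<^bsub>A\<^esub> a) m' b'"
    by (intro conjI ballI impI prod conc secs[THEN conjunct1] secs[THEN conjunct2])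
  then show ?case by (intro exI[of _ m'] exI[of _ b'])
qed

text \<open>Sections of \<open>1\<close> are \<open>1\<close>, so the induction hypothesis applies to all of them unless one is as
  long as the word; in that case \<open>1 = r d s\<close> with \<open>r s = 1\<close>, which forces \<open>d = 1\<close>.\<close>

lemma word_value_one_unique: "word_value \<one>\<^bsub>tree_Aut X\<^esub> n a \<Longrightarrow> a = \<one>\<^bsub>A\<^esub>"
proof (induction n arbitrary: a rule: less_induct)
  case (less n)
  obtain m b where
    secs: "\<And>x. x \<in> X \<Longrightarrow> word_value \<one>\<^bsub>tree_Aut X\<^esub> (m x) (b x) \<and> m x \<le> n"
    and prod: "a = finprod A b X"
    and conc: "\<And>x. x \<in> X \<Longrightarrow> m x = n \<Longrightarrow> \<exists>r\<in>X. \<exists>d\<in>D. \<exists>s\<in>X. s \<otimes> x = \<one> \<and>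
      \<one>\<^bsub>tree_Aut X\<^esub> = rooted r \<star> (d \<star> rooted s) \<and> \<phi> d = a"
    using word_value_sections[OF less.prems] by (auto simp: sec_one)
  show ?case
  proof (cases "\<exists>x\<in>X. m x = n")
    case True
    then obtain r d s where *: "r \<in> X" "d \<in> D" "s \<in> X"
      "\<one>\<^bsub>tree_Aut X\<^esub> = rooted r \<star> (d \<star> rooted s)" "\<phi> d = a"
      using conc by blast
    \<comment> \<open>Comparing root actions gives \<open>r s = 1\<close>, so \<open>d\<close> is a conjugate of \<open>1\<close>.\<close>
    have "root_elt \<one>\<^bsub>tree_Aut X\<^esub> = r \<otimes> s"
      unfolding *(4) using *(1-3)
      by (simp add: root_elt_mult rooted_in_G D_in_G G_mult root_elt_rooted root_elt_D)
    then have rs: "r \<otimes> s = \<one>" by (simp add: root_elt_def tree_Aut_one_apply)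
    then have "s \<otimes> r = \<one>" using * by (metis inv_equality r_inv)
    then have "rooted s \<star> rooted r = \<one>\<^bsub>tree_Aut X\<^esub>"
      using * by (simp add: rooted_mult[symmetric] rooted_one_eq)
    have "d = (rooted s \<star> rooted r) \<star> d \<star> (rooted s \<star> rooted r)"
      using *(1-3) \<open>rooted s \<star> rooted r = \<one>\<^bsub>tree_Aut X\<^esub>\<close> by (simp add: D_tree_auts)
    also have "\<dots> = rooted s \<star> (rooted r \<star> (d \<star> rooted s)) \<star> rooted r"
      using *(1-3) by (simp add: Aut.m_assoc D_tree_auts rooted_in_tree_auts tree_Aut_mult_closed)
    also have "\<dots> = \<one>\<^bsub>tree_Aut X\<^esub>"
      unfolding *(4)[symmetric] using *(1-3) \<open>rooted s \<star> rooted r = \<one>\<^bsub>tree_Aut X\<^esub>\<close>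
      by (simp add: rooted_in_tree_auts)
    finally show ?thesis using *(5) \<phi>_one by simp
  next
    case False
    then have "b x = \<one>\<^bsub>A\<^esub>" if "x \<in> X" for x
      using less.IH secs[OF that] that by (metis le_neq_implies_less)
    then show ?thesis unfolding prod by (rule A.finprod_one_eqI)
  qed
qed

lemma word_value_unique:
  assumes "word_value g n a" "word_value g m b"
  shows "a = b"
proof -
  have g: "g \<in> G" "a \<in> carrier A" "b \<in> carrier A" using assms word_value_closed by blast+
  then obtain k c where c: "word_value (inv\<^bsub>tree_Aut X\<^esub> g) k c"
    using word_value_total subgroup.m_inv_closed[OF subgroup_G] by blast
  have "a \<otimes>\<^bsub>A\<^esub> c = \<one>\<^bsub>A\<^esub>" "b \<otimes>\<^bsub>A\<^esub> c = \<one>\<^bsub>A\<^esub>"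
    using word_value_mult[OF _ c] assms word_value_one_unique g Aut.r_inv[of g]
    by (metis G_tree_auts carrier_tree_Aut)+
  then show ?thesis using g word_value_closed[OF c] by (metis A.inv_equality A.m_comm)
qed

theorem hom_extends_to_G:
  "\<exists>\<epsilon>. \<epsilon> \<in> hom (tree_Aut X\<lparr>carrier := G\<rparr>) A \<and>
    (\<forall>r\<in>X. \<epsilon> (rooted r) = \<one>\<^bsub>A\<^esub>) \<and> (\<forall>d\<in>D. \<epsilon> d = \<phi> d)"
proof -
  define \<epsilon> where "\<epsilon> = (\<lambda>g. SOME a. \<exists>n. word_value g n a)"
  have val: "\<exists>n. word_value g n (\<epsilon> g)" if "g \<in> G" for g
    unfolding \<epsilon>_def using someI_ex[of "\<lambda>a. \<exists>n. word_value g n a"] word_value_total[OF that] by blast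
  have eq: "\<epsilon> g = a" if "word_value g n a" for g n a
    using val word_value_unique that word_value_closed by blast
  have "\<epsilon> (g \<star> h) = \<epsilon> g \<otimes>\<^bsub>A\<^esub> \<epsilon> h" if "g \<in> G" "h \<in> G" for g h
    using val[OF that(1)] val[OF that(2)] word_value_mult eq by blast
  moreover have "\<epsilon> g \<in> carrier A" if "g \<in> G" for g
    using val[OF that] word_value_closed by blast
  moreover have "\<epsilon> (rooted r) = \<one>\<^bsub>A\<^esub>" if "r \<in> X" for r
    using eq word_value_rooted[OF that] by blast
  moreover have "\<epsilon> d = \<phi> d" if "d \<in> D" for d
    using eq word_value_directed[OF that] by blast
  ultimately show ?thesis
    by (intro exI[of _ \<epsilon>]) (simp add: hom_def)
qed

end

section \<open>Root actions of the sections of an element\<close>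

context constant_spinal
begin

text \<open>The homomorphism \<open>\<epsilon> z\<close> collects the images under \<open>\<chi>\<close> of the contributions \<open>d|z\<close> of the
  directed factors \<open>d\<close> of its argument. A directed factor that passes to the section at \<open>y\<close> stands to the left of an element
  whose root action is \<open>y\<inverse>\<close>; that element moves \<open>x\<close> to \<open>y\<inverse>x\<close>, so the factor leaves its
  section at \<open>y\<inverse>x\<close> in the section at \<open>x\<close>. This explains the index of \<open>\<epsilon>\<close>. The term for \<open>y = x\<close> is
  harmless: directed automorphisms have trivial root action, so \<open>\<epsilon> \<one>\<close> is trivial on \<open>D\<close>.\<close>

lemma root_elt_sections:
  assumes A: "comm_group A" and \<chi>: "\<chi> \<in> hom R A"
    and \<epsilon>: "\<And>z. z \<in> X \<Longrightarrow> \<epsilon> z \<in> hom (tree_Aut X\<lparr>carrier := G\<rparr>) A"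
    and \<epsilon>_rooted: "\<And>z r. z \<in> X \<Longrightarrow> r \<in> X \<Longrightarrow> \<epsilon> z (rooted r) = \<one>\<^bsub>A\<^esub>"
    and \<epsilon>_D: "\<And>z d. z \<in> X \<Longrightarrow> d \<in> D \<Longrightarrow> \<epsilon> z d = \<chi> (root_elt (sec d z))"
    and g: "g \<in> G" and x: "x \<in> X"
  shows "\<chi> (root_elt (sec g x)) = finprod A (\<lambda>y. \<epsilon> (inv y \<otimes> x) (sec g y)) X"
  using g
proof (induction rule: G_induct)
  interpret A: comm_group A by (rule A)
  interpret \<chi>: group_hom R A \<chi> by unfold_locales (rule \<chi>)
  case one
  have "\<epsilon> (inv y \<otimes> x) \<one>\<^bsub>tree_Aut X\<^esub> = \<one>\<^bsub>A\<^esub>" if "y \<in> X" for y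
    using \<epsilon>_rooted[of "inv y \<otimes> x" \<one>] that x by (simp add: rooted_one_eq)
  then have "finprod A (\<lambda>y. \<epsilon> (inv y \<otimes> x) (sec \<one>\<^bsub>tree_Aut X\<^esub> y)) X = \<one>\<^bsub>A\<^esub>"
    by (intro A.finprod_one_eqI) (simp add: sec_one)
  then show ?case using x by (simp add: sec_one root_elt_one)
next
  interpret A: comm_group A by (rule A)
  case (rooted r k)
  have "finprod A (\<lambda>y. \<epsilon> (inv y \<otimes> x) (sec (rooted_aut R r \<star> k) y)) X =
      finprod A (\<lambda>y. \<epsilon> (inv y \<otimes> x) (sec k y)) X"
    by (rule A.finprod_cong')
      (use rooted x \<epsilon> sec_in_G in \<open>auto simp: sec_rooted_mult hom_def Pi_iff\<close>)
  then show ?case using rooted x by (simp add: sec_rooted_mult)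
next
  interpret A: comm_group A by (rule A)
  interpret \<chi>: group_hom R A \<chi> by unfold_locales (rule \<chi>)
  case (directed d k)
  note d = directed.hyps(1) and k = directed.hyps(2)
  \<comment> \<open>Only the section of \<open>d \<star> k\<close> at the letter that \<open>k\<close> moves to \<open>\<one>\<close> involves \<open>d\<close> itself.\<close>
  define y\<^sub>0 where "y\<^sub>0 = inv (root_elt k)"
  have y\<^sub>0: "y\<^sub>0 \<in> X" "inv y\<^sub>0 = root_elt k" using k by (simp_all add: y\<^sub>0_def root_elt_closed)
  define f where "f = (\<lambda>y. \<epsilon> (inv y \<otimes> x) (sec k y))"
  have f: "f \<in> X \<rightarrow> carrier A"
    using \<epsilon> x k sec_in_G by (auto simp: f_def hom_def Pi_iff)
  define c where "c = \<chi> (root_elt (sec d (root_elt k \<otimes> x)))"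
  have c: "c \<in> carrier A"
    using d k x by (simp add: c_def sec_D_in_G root_elt_closed)
  have "\<epsilon> (inv y \<otimes> x) (sec (d \<star> k) y) = (if y = y\<^sub>0 then c else \<one>\<^bsub>A\<^esub>) \<otimes>\<^bsub>A\<^esub> f y" if y: "y \<in> X" for y
  proof -
    have z: "inv y \<otimes> x \<in> X" using x y by simp
    have "sec (d \<star> k) y = sec d (root_elt k \<otimes> y) \<star> sec k y"
      using d k y by (simp add: sec_mult D_in_G)
    then have *: "\<epsilon> (inv y \<otimes> x) (sec (d \<star> k) y) = \<epsilon> (inv y \<otimes> x) (sec d (root_elt k \<otimes> y)) \<otimes>\<^bsub>A\<^esub> f y"
      using \<epsilon>[OF z] d k y by (simp add: f_def hom_def sec_in_G D_in_G root_elt_closed)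
    show ?thesis
    proof (cases "y = y\<^sub>0")
      case True
      then have "root_elt k \<otimes> y = \<one>" using k by (simp add: y\<^sub>0_def root_elt_closed)
      then have "\<epsilon> (inv y \<otimes> x) (sec d (root_elt k \<otimes> y)) = c"
        using d z True y\<^sub>0 by (simp add: sec_D_one \<epsilon>_D c_def)
      then show ?thesis using * True by simp
    next
      case False
      have "root_elt k \<otimes> y \<noteq> \<one>"
      proof
        assume "root_elt k \<otimes> y = \<one>"
        then have "y = y\<^sub>0" unfolding y\<^sub>0_def
          using inv_unique'[of "root_elt k" y] inv_comm[of "root_elt k" y] k y
          by (simp add: root_elt_closed)
        then show False using False by simp
      qed
      then obtain r where "r \<in> X" "sec d (root_elt k \<otimes> y) = rooted r"
        using sec_D[OF d, of "root_elt k \<otimes> y"] k y by (auto simp: root_elt_closed)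
      then show ?thesis using * z False by (simp add: \<epsilon>_rooted)
    qed
  qed
  then have "finprod A (\<lambda>y. \<epsilon> (inv y \<otimes> x) (sec (d \<star> k) y)) X =
      finprod A (\<lambda>y. (if y = y\<^sub>0 then c else \<one>\<^bsub>A\<^esub>) \<otimes>\<^bsub>A\<^esub> f y) X"
    by (intro A.finprod_cong') (use f c in auto)
  also have "\<dots> = finprod A (\<lambda>y. if y = y\<^sub>0 then c else \<one>\<^bsub>A\<^esub>) X \<otimes>\<^bsub>A\<^esub> finprod A f X"
    by (rule A.finprod_multf) (use f c in auto)
  also have "finprod A (\<lambda>y. if y = y\<^sub>0 then c else \<one>\<^bsub>A\<^esub>) X = c"
    by (rule A.finprod_singleton_swap[OF y\<^sub>0(1) finite_X, of "\<lambda>_. c"]) (simp add: c)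
  also have "finprod A f X = \<chi> (root_elt (sec k x))" using directed.IH by (simp add: f_def)
  also have "c \<otimes>\<^bsub>A\<^esub> \<chi> (root_elt (sec k x)) = \<chi> (root_elt (sec (d \<star> k) x))"
    using d k x by (simp add: c_def sec_mult D_in_G root_elt_mult sec_in_G root_elt_closed)
  finally show ?case by simp
qed

lemma group_G: "group (tree_Aut X\<lparr>carrier := G\<rparr>)"
  using Aut.subgroup_imp_group[OF subgroup_G] .

lemma hom_G_derived:
  assumes "comm_group A" "\<epsilon> \<in> hom (tree_Aut X\<lparr>carrier := G\<rparr>) A" "c \<in> derived (tree_Aut X) G"
  shows "\<epsilon> c = \<one>\<^bsub>A\<^esub>"
proof -
  have "group_hom (tree_Aut X\<lparr>carrier := G\<rparr>) A \<epsilon>"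
    using group_G assms by (simp add: group_hom_def group_hom_axioms_def comm_group.axioms)
  then show ?thesis
    using group_hom.hom_comm_group_derived[of "tree_Aut X\<lparr>carrier := G\<rparr>" A \<epsilon> G c] assms
      Aut.derived_consistent[OF subset_refl subgroup_G] by auto
qed

text \<open>With \<open>\<chi>\<close> the projection \<open>R \<rightarrow> R/R'\<close>, the extended homomorphisms \<open>\<epsilon> z\<close> vanish on rooted
  automorphisms and on \<open>G'\<close>, hence on all the sections; the previous formula then says that their
  root actions lie in \<open>R'\<close>.\<close>

lemma sections_mod_derived:
  assumes g: "g \<in> G"
    and r: "\<And>y. y \<in> X \<Longrightarrow> r y \<in> X"
    and c: "\<And>y. y \<in> X \<Longrightarrow> c y \<in> derived (tree_Aut X) G"
    and sec: "\<And>y. y \<in> X \<Longrightarrow> sec g y = rooted (r y) \<star> c y"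
    and x: "x \<in> X"
  shows "r x \<in> derived R X"
proof -
  interpret N: normal "derived R X" R by (rule derived_self_is_normal)
  let ?A = "R Mod derived R X"
  let ?\<chi> = "\<lambda>a. derived R X #> a"
  interpret A: comm_group ?A by (rule derived_quot_is_comm_group)
  interpret \<chi>: group_hom R ?A ?\<chi>
    by unfold_locales (rule N.r_coset_hom_Mod)
  have cG: "c y \<in> G" if "y \<in> X" for y
    using Aut.derived_incl[OF subset_refl subgroup_G] c[OF that] by blast
  have "\<exists>\<epsilon>. \<epsilon> \<in> hom (tree_Aut X\<lparr>carrier := G\<rparr>) ?A \<and> (\<forall>a\<in>X. \<epsilon> (rooted a) = \<one>\<^bsub>?A\<^esub>) \<and>
      (\<forall>d\<in>D. \<epsilon> d = ?\<chi> (root_elt (sec d z)))" if z: "z \<in> X" for z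
  proof -
    have "sec (d \<star> e) z = sec d z \<star> sec e z" if "d \<in> D" "e \<in> D" for d e
      using that z by (simp add: sec_mult D_in_G root_elt_D)
    then have "(\<lambda>d. ?\<chi> (root_elt (sec d z))) \<in> hom (tree_Aut X\<lparr>carrier := D\<rparr>) ?A"
      using z by (auto simp: hom_def root_elt_mult sec_D_in_G root_elt_closed
          simp del: FactGroup_def mult_FactGroup)
    then interpret constant_spinal_hom R D ?A "\<lambda>d. ?\<chi> (root_elt (sec d z))"
      by unfold_locales
    show ?thesis by (rule hom_extends_to_G)
  qed
  then obtain \<epsilon> where \<epsilon>:
    "\<And>z. z \<in> X \<Longrightarrow> \<epsilon> z \<in> hom (tree_Aut X\<lparr>carrier := G\<rparr>) ?A"
    "\<And>z a. z \<in> X \<Longrightarrow> a \<in> X \<Longrightarrow> \<epsilon> z (rooted a) = \<one>\<^bsub>?A\<^esub>"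
    "\<And>z d. z \<in> X \<Longrightarrow> d \<in> D \<Longrightarrow> \<epsilon> z d = ?\<chi> (root_elt (sec d z))"
    by metis
  have "\<epsilon> (inv y \<otimes> x) (sec g y) = \<one>\<^bsub>?A\<^esub>" if y: "y \<in> X" for y
  proof -
    have z: "inv y \<otimes> x \<in> X" using x y by simp
    have "\<epsilon> (inv y \<otimes> x) (rooted (r y) \<star> c y) =
        \<epsilon> (inv y \<otimes> x) (rooted (r y)) \<otimes>\<^bsub>?A\<^esub> \<epsilon> (inv y \<otimes> x) (c y)"
      using hom_mult[OF \<epsilon>(1)[OF z], of "rooted (r y)" "c y"] y by (simp add: rooted_in_G r cG)
    then show ?thesis
      using \<epsilon>(2)[OF z r[OF y]] hom_G_derived[OF derived_quot_is_comm_group \<epsilon>(1)[OF z] c[OF y]] sec[OF y]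
        A.l_one[OF A.one_closed] by simp
  qed
  then have "finprod ?A (\<lambda>y. \<epsilon> (inv y \<otimes> x) (sec g y)) X = \<one>\<^bsub>?A\<^esub>"
    by (rule A.finprod_one_eqI)
  moreover have "?\<chi> (root_elt (sec g x)) = finprod ?A (\<lambda>y. \<epsilon> (inv y \<otimes> x) (sec g y)) X"
    by (rule root_elt_sections[OF derived_quot_is_comm_group \<chi>.homh _ _ _ g x])
      (rule \<epsilon>, assumption+)+
  ultimately have "?\<chi> (root_elt (sec g x)) = \<one>\<^bsub>?A\<^esub>" by argo
  moreover have "?\<chi> (root_elt (c x)) = \<one>\<^bsub>?A\<^esub>"
  proof (rule hom_G_derived[OF derived_quot_is_comm_group _ c[OF x]])
    show "(\<lambda>g. ?\<chi> (root_elt g)) \<in> hom (tree_Aut X\<lparr>carrier := G\<rparr>) ?A"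
      by (auto simp: hom_def root_elt_mult root_elt_closed simp del: FactGroup_def mult_FactGroup)
  qed
  moreover have "root_elt (sec g x) = r x \<otimes> root_elt (c x)"
    using sec[OF x] r[OF x] cG[OF x] by (simp add: root_elt_mult rooted_in_G root_elt_rooted)
  moreover have "?\<chi> (r x \<otimes> root_elt (c x)) = ?\<chi> (r x) \<otimes>\<^bsub>?A\<^esub> ?\<chi> (root_elt (c x))"
    by (rule \<chi>.hom_mult[OF r[OF x] root_elt_closed[OF cG[OF x]]])
  ultimately have "?\<chi> (r x) = \<one>\<^bsub>?A\<^esub>"
    using A.r_one[OF \<chi>.hom_closed[OF r[OF x]]] by argo
  then have "derived R X #> r x = derived R X" by (simp add: FactGroup_def)
  then show ?thesis using rcos_self[OF r[OF x] N.subgroup_axioms] by simp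
qed

lemma rooted_derived:
  assumes "r \<in> derived R X"
  shows "rooted r \<in> derived (tree_Aut X) G"
proof -
  have "rooted r \<in> derived (tree_Aut X) (rooted ` X)"
    using group_hom.derived_img[OF rooted_group_hom subset_refl] assms by blast
  then show ?thesis
    using Aut.mono_derived[of "rooted ` X" G] rooted_in_G by blast
qed

section \<open>Subgroups generated by the rooted and by fewer directed automorphisms\<close>

text \<open>The letters are treated one after the other. This is possible because a step alters the sections
  at the other letters by rooted factors on the left only, and products \<open>r c\<close> absorb those.\<close>

lemma spinal_subgroup_adjust:
  assumes T: "constant_spinal R T" "T \<subseteq> D"
    and g: "g \<in> G" and gH: "\<And>x. x \<in> X \<Longrightarrow> sec g x \<in> spinal_group R T"
    and F: "F \<subseteq> X"
  shows "\<exists>k\<in>spinal_group R T. (\<forall>x\<in>X. sec (k \<star> g) x \<in> spinal_group R T) \<and>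
    (\<forall>x\<in>F. \<exists>r\<in>X. \<exists>c\<in>derived (tree_Aut X) (spinal_group R T). sec (k \<star> g) x = rooted r \<star> c)"
proof -
  interpret T: constant_spinal R T by (rule T(1))
  let ?H = "spinal_group R T"
  let ?H' = "derived (tree_Aut X) ?H"
  have HG: "?H \<subseteq> G"
    unfolding spinal_group_def using T(2) by (intro Aut.mono_generate) blast
  have H'H: "?H' \<subseteq> ?H" using Aut.derived_incl[OF subset_refl T.subgroup_G] .
  show ?thesis
    using finite_subset[OF F finite_X] F
  proof (induction F rule: finite_induct)
    case empty
    have "\<one>\<^bsub>tree_Aut X\<^esub> \<in> ?H" using T.subgroup_G by (rule subgroup.one_closed)
    then show ?case using gH g by (intro bexI[of _ "\<one>\<^bsub>tree_Aut X\<^esub>"]) (simp_all add: G_tree_auts)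
  next
    case (insert y F)
    then obtain k where k: "k \<in> ?H" and kH: "\<And>x. x \<in> X \<Longrightarrow> sec (k \<star> g) x \<in> ?H"
      and kF: "\<And>x. x \<in> F \<Longrightarrow> \<exists>r\<in>X. \<exists>c\<in>?H'. sec (k \<star> g) x = rooted r \<star> c"
      by auto
    have y: "y \<in> X" using insert by simp
    define g' where "g' = k \<star> g"
    have g': "g' \<in> G" using k g HG by (auto simp: g'_def intro: G_mult)
    have "\<exists>t\<in>T. \<exists>q\<in>rooted_auts R. \<exists>c\<in>?H'. sec g' y = t \<star> q \<star> c"
      using Aut.generate_Un_subgroups_decomp[OF T.subgroup_D subgroup_rooted_auts, of "sec g' y"]
        kH[OF y] by (simp add: g'_def spinal_group_def Un_commute)
    then obtain t r c where t: "t \<in> T" and r: "r \<in> X" and c: "c \<in> ?H'"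
      and gy: "sec g' y = t \<star> rooted r \<star> c" unfolding rooted_auts_def by blast
    have cA: "c \<in> tree_auts X" using c H'H T.G_tree_auts by blast
    define t' where "t' = inv\<^bsub>tree_Aut X\<^esub> t"
    have t': "t' \<in> T" unfolding t'_def using T.subgroup_D t by (rule subgroup.m_inv_closed)
    \<comment> \<open>As \<open>t'\<close> is its own section at \<open>\<one>\<close>, the rooted factor has to move the image of \<open>y\<close> under
       \<open>g'\<close> to \<open>\<one>\<close>.\<close>
    define s where "s = inv (root_elt g' \<otimes> y)"
    have s: "s \<in> X" using y g' by (simp add: s_def root_elt_closed)
    define k' where "k' = t' \<star> rooted s"
    have k': "k' \<in> ?H" using t' s by (simp add: k'_def T.G_mult T.D_in_G T.rooted_in_G)
    have secs: "sec (k' \<star> g') x = sec t' (s \<otimes> (root_elt g' \<otimes> x)) \<star> sec g' x" if x: "x \<in> X" for x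
    proof -
      have "sec k' z = sec t' (s \<otimes> z)" if "z \<in> X" for z
        unfolding k'_def using t' s that T(2) T.D_tree_auts[OF t']
        by (subst T.sec_mult)
          (simp_all add: T.D_in_G T.rooted_in_G sec_rooted root_elt_rooted T.sec_tree_auts)
      then show ?thesis
        using x g' k' HG by (subst sec_mult) (auto simp: root_elt_closed)
    qed
    have "sec (k' \<star> g') y = rooted r \<star> c"
    proof -
      have "sec (k' \<star> g') y = t' \<star> (t \<star> rooted r \<star> c)"
        using secs[OF y] y g' t' by (simp add: s_def root_elt_closed T.sec_D_one gy)
      also have "\<dots> = (t' \<star> t) \<star> (rooted r \<star> c)"
        using t t' r cA by (simp add: Aut.m_assoc T.D_tree_auts rooted_in_tree_auts)
      also have "t' \<star> t = \<one>\<^bsub>tree_Aut X\<^esub>"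
        using t by (simp add: t'_def Aut.l_inv T.D_tree_auts)
      finally show ?thesis using r cA by (simp add: rooted_in_tree_auts)
    qed
    moreover have "\<exists>r\<in>X. \<exists>c\<in>?H'. sec (k' \<star> g') x = rooted r \<star> c" if x: "x \<in> F" for x
    proof -
      have xX: "x \<in> X" and xy: "x \<noteq> y" using x insert by auto
      have "s \<otimes> (root_elt g' \<otimes> x) \<noteq> \<one>"
      proof
        assume "s \<otimes> (root_elt g' \<otimes> x) = \<one>"
        also have "\<one> = s \<otimes> (root_elt g' \<otimes> y)" using y g' by (simp add: s_def root_elt_closed)
        finally show False using xX xy y s g' by (simp add: root_elt_closed)
      qed
      then obtain a where a: "a \<in> X" "sec t' (s \<otimes> (root_elt g' \<otimes> x)) = rooted a"
        using T.sec_D[OF t', of "s \<otimes> (root_elt g' \<otimes> x)"] s g' xX by (auto simp: root_elt_closed)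
      obtain b e where b: "b \<in> X" "e \<in> ?H'" "sec g' x = rooted b \<star> e"
        using kF[OF x] by (auto simp: g'_def)
      have "e \<in> tree_auts X" using b H'H T.G_tree_auts by blast
      then have "sec (k' \<star> g') x = rooted (a \<otimes> b) \<star> e"
        using secs[OF xX] a b by (simp add: rooted_mult Aut.m_assoc rooted_in_tree_auts)
      then show ?thesis using a b by blast
    qed
    moreover have "sec (k' \<star> g') x \<in> ?H" if x: "x \<in> X" for x
      using secs[OF x] T.sec_in_G[OF T.D_in_G[OF t']] T.G_mult kH[OF x] x s g'
      by (simp add: g'_def root_elt_closed)
    moreover have "k' \<star> k \<in> ?H" using T.G_mult k k' by blast
    moreover have "(k' \<star> k) \<star> g = k' \<star> g'"
      using k k' g T.G_tree_auts by (simp add: g'_def Aut.m_assoc G_tree_auts)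
    ultimately show ?case
      using r c by (intro bexI[of _ "k' \<star> k"]) auto
  qed
qed

lemma level1_sections_in_spinal_subgroup:
  assumes T: "constant_spinal R T" "T \<subseteq> D"
    and branch: "{level1_aut X k | k. \<forall>x\<in>X. k x \<in> derived (tree_Aut X) (spinal_group R T)}
      \<subseteq> spinal_group R T"
    and g: "g \<in> G" and gH: "\<And>x. x \<in> X \<Longrightarrow> sec g x \<in> spinal_group R T"
  shows "g \<in> spinal_group R T"
proof -
  interpret T: constant_spinal R T by (rule T(1))
  let ?H = "spinal_group R T"
  let ?H' = "derived (tree_Aut X) ?H"
  have HG: "?H \<subseteq> G"
    unfolding spinal_group_def using T(2) by (intro Aut.mono_generate) blast
  have H'G': "?H' \<subseteq> derived (tree_Aut X) G" using HG by (rule Aut.mono_derived)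
  obtain k where k: "k \<in> ?H" and kg: "\<forall>x\<in>X. \<exists>r\<in>X. \<exists>c\<in>?H'. sec (k \<star> g) x = rooted r \<star> c"
    using spinal_subgroup_adjust[OF T g gH subset_refl] by blast
  then obtain r c where rc: "\<And>x. x \<in> X \<Longrightarrow> r x \<in> X" "\<And>x. x \<in> X \<Longrightarrow> c x \<in> ?H'"
    "\<And>x. x \<in> X \<Longrightarrow> sec (k \<star> g) x = rooted (r x) \<star> c x"
    by metis
  have kgG: "k \<star> g \<in> G" using k g HG by (auto intro: G_mult)
  have secs: "sec (k \<star> g) x \<in> ?H'" if x: "x \<in> X" for x
  proof -
    have "r x \<in> derived R X"
      using sections_mod_derived[OF kgG, of r c x] rc H'G' x by blast
    then have "rooted (r x) \<in> ?H'" by (rule T.rooted_derived)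
    then show ?thesis
      using rc x subgroup.m_closed[OF Aut.derived_is_subgroup] T.subgroup_G
      by (simp add: subgroup_def)
  qed
  \<comment> \<open>A rooted factor on the left undoes the root action without changing any section.\<close>
  define q where "q = rooted (inv (root_elt (k \<star> g)))"
  have q: "q \<in> ?H" using kgG by (simp add: q_def T.rooted_in_G root_elt_closed)
  have "q \<star> (k \<star> g) = level1_aut X (\<lambda>x. sec (q \<star> (k \<star> g)) x)"
  proof (rule level1_aut_sections)
    show "q \<star> (k \<star> g) \<in> tree_auts X" using q kgG T.G_tree_auts G_tree_auts by simp
    show "(q \<star> (k \<star> g)) [x] = [x]" if "x \<in> X" for x
      using that kgG q
      by (simp add: tree_Aut_mult_apply T.G_tree_auts G_tree_auts G_letter q_def rooted_Cons
          root_elt_closed m_assoc[symmetric])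
  qed
  moreover have "\<forall>x\<in>X. sec (q \<star> (k \<star> g)) x \<in> ?H'"
    using secs kgG by (simp add: q_def sec_rooted_mult root_elt_closed)
  ultimately have qkg: "q \<star> (k \<star> g) \<in> ?H" using branch by blast
  have qk: "q \<star> k \<in> ?H" using q k by (rule T.G_mult)
  have "g = inv\<^bsub>tree_Aut X\<^esub> (q \<star> k) \<star> (q \<star> (k \<star> g))"
    using q k g T.G_tree_auts by (simp add: Aut.inv_solve_left Aut.m_assoc G_tree_auts)
  then show ?thesis
    using T.G_mult[OF subgroup.m_inv_closed[OF T.subgroup_G qk] qkg] by simp
qed

end

section \<open>Sections at an arbitrary level\<close>

theorem proposition5p2:
  fixes R :: "('r, 'b) monoid_scheme"
    and D T G H :: "('r list \<Rightarrow> 'r list) set"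
    and g :: "'r list \<Rightarrow> 'r list"
    and n :: nat
  assumes "constant_spinal_data R D"
    and "G = spinal_group R D"
    and "subgroup T (tree_Aut (carrier R))" and "T \<subseteq> D" and "Gen R T"
    and "H = spinal_group R T"
    and "regular_branch_over (carrier R) H (derived (tree_Aut (carrier R)) H)"
    and "g \<in> G"
    and "\<forall>u\<in>lists (carrier R). length u = n \<longrightarrow> tree_section (carrier R) g u \<in> H"
  shows "g \<in> H"
proof -
  let ?X = "carrier R" and ?A = "tree_Aut (carrier R)"
  interpret constant_spinal R D by unfold_locales (rule assms(1))
  have T: "constant_spinal R T"
    using assms(1-5) by unfold_locales (auto simp: constant_spinal_data_def)
  have "subgroup {level1_aut ?X k | k. \<forall>x\<in>?X. k x \<in> derived ?A H}
      (?A\<lparr>carrier := derived ?A H\<rparr>)"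
    using assms(7) unfolding regular_branch_over_def finite_index_subgroup_def by blast
  from subgroup.subset[OF this]
  have "{level1_aut ?X k | k. \<forall>x\<in>?X. k x \<in> derived ?A H} \<subseteq> derived ?A H" by simp
  also have "derived ?A H \<subseteq> H"
    using constant_spinal.subgroup_G[OF T] assms(6) Aut.derived_incl by blast
  finally have branch: "{level1_aut ?X k | k. \<forall>x\<in>?X. k x \<in> derived ?A H} \<subseteq> H" .
  have "f \<in> H" if "f \<in> spinal_group R D"
    "\<forall>u\<in>lists ?X. length u = m \<longrightarrow> tree_section ?X f u \<in> H" for f m
    using that
  proof (induction m arbitrary: f)
    case 0
    then show ?case using tree_section_Nil[OF G_tree_auts[OF 0(1)]] by auto
  next
    case (Suc m)
    have "tree_section ?X f [x] \<in> H" if x: "x \<in> ?X" for x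
    proof (rule Suc.IH)
      show "tree_section ?X f [x] \<in> spinal_group R D" using sec_in_G[OF Suc.prems(1) x] .
      show "\<forall>u\<in>lists ?X. length u = m \<longrightarrow> tree_section ?X (tree_section ?X f [x]) u \<in> H"
        using Suc.prems(2) x by (simp add: tree_section_section_singleton)
    qed
    then show ?case
      using level1_sections_in_spinal_subgroup[OF T assms(4) _ Suc.prems(1)] branch assms(6)
      by blast
  qed
  then show ?thesis using assms(2,8,9) by blast
qed

end
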